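(* Let $J\dashv K:\mathcal{C}\to\mathcal{D}$ be an adjunction such that $J$ is part of a 1-cell $(J,\psi^{J}):(\mathcal{C},S)\to(\mathcal{D},T)$ in $\mathbf{Mnd}(\mathbf{Cat})$. The following assertions are equivalent: (i) $K$ extends to a 1-cell $(K,\psi^{K}):(\mathcal{D},T)\to(\mathcal{C},S)$ such that there is an adjoint object $(J,\psi^{J})\dashv(K,\psi^{K})$ in $\mathbf{Mnd}(\mathbf{Cat})$ with unit $\eta^{KJ}$ and counit $\varepsilon^{JK}$ those of $J\dashv K$; (ii) $\psi^{J}$ is invertible. In such a case, $\psi^{K}=\mathrm{ad}(\psi^{J})$, i.e. $\psi^{K}=KT\varepsilon^{JK}\circ K(\psi^{J})^{-1}K\circ\eta^{KJ}SK$.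
   Context: All categories are small; juxtaposition denotes composition of functors and whiskering. $J\dashv K:\mathcal{C}\to\mathcal{D}$ means $J:\mathcal{C}\to\mathcal{D}$ is left adjoint to $K$, with unit $\eta^{KJ}$ and counit $\varepsilon^{JK}$. $\mathbf{Mnd}(\mathbf{Cat})$: 0-cells are monads $(\mathcal{C},S,\mu^S,\eta^S)$, written $(\mathcal{C},S)$; a 1-cell $(B,\psi^B):(\mathcal{C},S)\to(\mathcal{D},T)$ is a functor $B:\mathcal{C}\to\mathcal{D}$ with $\psi^B:TB\to BS$ satisfying $\psi^B\circ\mu^TB=B\mu^S\circ\psi^BS\circ T\psi^B$ and $\psi^B\circ\eta^TB=B\eta^S$; a 2-cell $\theta:(A,\psi^A)\to(B,\psi^B)$ is a natural transformation $\theta:A\to B$ with $\psi^B\circ T\theta=\theta S\circ\psi^A$. The composite $(K,\psi^K)(J,\psi^J)$ is $(KJ,K\psi^J\circ\psi^KJ)$, and identity 1-cells are $(1_{\mathcal{C}},1_S)$. An adjoint object $(J,\psi^J)\dashv(K,\psi^K)$ consists of 1-cells $(J,\psi^J):(\mathcal{C},S)\to(\mathcal{D},T)$, $(K,\psi^K):(\mathcal{D},T)\to(\mathcal{C},S)$ and 2-cells $\eta^{KJ}:(1_{\mathcal{C}},1_S)\to(KJ,K\psi^J\circ\psi^KJ)$ and $\varepsilon^{JK}:(JK,J\psi^K\circ\psi^JK)\to(1_{\mathcal{D}},1_T)$ satisfying the triangular identities. *)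

theory Defs
  imports Main
begin

section \<open>Categories, functors and natural transformations\<close>

record ('o, 'a) cat =
  Obj :: "'o set"
  Arr :: "'a set"
  Dom :: "'a \<Rightarrow> 'o"
  Cod :: "'a \<Rightarrow> 'o"
  Ident :: "'o \<Rightarrow> 'a"
  Comp :: "'a \<Rightarrow> 'a \<Rightarrow> 'a"

text \<open>\<open>Comp C g f\<close> is the composite ``\<open>g\<close> after \<open>f\<close>''.\<close>

definition Hom :: "('o, 'a) cat \<Rightarrow> 'o \<Rightarrow> 'o \<Rightarrow> 'a set" where
  "Hom C X Y = {f \<in> Arr C. Dom C f = X \<and> Cod C f = Y}"

locale category =
  fixes C :: "('o, 'a) cat"
  assumes Dom_Obj: "f \<in> Arr C \<Longrightarrow> Dom C f \<in> Obj C"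
    and Cod_Obj: "f \<in> Arr C \<Longrightarrow> Cod C f \<in> Obj C"
    and Ident_Hom: "X \<in> Obj C \<Longrightarrow> Ident C X \<in> Hom C X X"
    and Comp_Hom: "\<lbrakk>f \<in> Hom C X Y; g \<in> Hom C Y Z\<rbrakk> \<Longrightarrow> Comp C g f \<in> Hom C X Z"
    and Comp_Ident_right: "f \<in> Hom C X Y \<Longrightarrow> Comp C f (Ident C X) = f"
    and Comp_Ident_left: "f \<in> Hom C X Y \<Longrightarrow> Comp C (Ident C Y) f = f"
    and Comp_assoc: "\<lbrakk>f \<in> Hom C W X; g \<in> Hom C X Y; h \<in> Hom C Y Z\<rbrakk>
      \<Longrightarrow> Comp C h (Comp C g f) = Comp C (Comp C h g) f"

record ('o, 'a, 'p, 'b) fctr =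
  omap :: "'o \<Rightarrow> 'p"
  amap :: "'a \<Rightarrow> 'b"

locale cat_functor = source: category C + target: category D
  for C :: "('o, 'a) cat" and D :: "('p, 'b) cat" +
  fixes F :: "('o, 'a, 'p, 'b) fctr"
  assumes omap_Obj: "X \<in> Obj C \<Longrightarrow> omap F X \<in> Obj D"
    and amap_Hom: "f \<in> Hom C X Y \<Longrightarrow> amap F f \<in> Hom D (omap F X) (omap F Y)"
    and amap_Ident: "X \<in> Obj C \<Longrightarrow> amap F (Ident C X) = Ident D (omap F X)"
    and amap_Comp: "\<lbrakk>f \<in> Hom C X Y; g \<in> Hom C Y Z\<rbrakk>
      \<Longrightarrow> amap F (Comp C g f) = Comp D (amap F g) (amap F f)"

definition id_fctr :: "('o, 'a, 'o, 'a) fctr" where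
  "id_fctr = \<lparr>omap = (\<lambda>X. X), amap = (\<lambda>f. f)\<rparr>"

definition fcomp :: "('p, 'b, 'q, 'c) fctr \<Rightarrow> ('o, 'a, 'p, 'b) fctr \<Rightarrow> ('o, 'a, 'q, 'c) fctr"
    (infixr "\<circ>\<^sub>F" 80) where
  "G \<circ>\<^sub>F F = \<lparr>omap = (\<lambda>X. omap G (omap F X)), amap = (\<lambda>f. amap G (amap F f))\<rparr>"

text \<open>
  A natural transformation is given by its family of components, indexed by the objects of the
  source category; the values of the family at other elements of the type are irrelevant.
  Accordingly, equality of natural transformations is \<open>nt_eq\<close> and not HOL equality.
\<close>

type_synonym ('o, 'b) ntrans = "'o \<Rightarrow> 'b"

definition nt_eq :: "('o, 'a) cat \<Rightarrow> ('o, 'b) ntrans \<Rightarrow> ('o, 'b) ntrans \<Rightarrow> bool" where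
  "nt_eq C \<alpha> \<beta> \<longleftrightarrow> (\<forall>X \<in> Obj C. \<alpha> X = \<beta> X)"

locale natural_transformation = source: cat_functor C D F + target: cat_functor C D G
  for C :: "('o, 'a) cat" and D :: "('p, 'b) cat"
    and F G :: "('o, 'a, 'p, 'b) fctr" +
  fixes \<alpha> :: "('o, 'b) ntrans"
  assumes component: "X \<in> Obj C \<Longrightarrow> \<alpha> X \<in> Hom D (omap F X) (omap G X)"
    and naturality: "f \<in> Hom C X Y
      \<Longrightarrow> Comp D (\<alpha> Y) (amap F f) = Comp D (amap G f) (\<alpha> X)"

definition id_nt :: "('p, 'b) cat \<Rightarrow> ('o, 'a, 'p, 'b) fctr \<Rightarrow> ('o, 'b) ntrans" where
  "id_nt D F = (\<lambda>X. Ident D (omap F X))"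

definition vcomp :: "('o, 'b) ntrans \<Rightarrow> ('p, 'b) cat \<Rightarrow> ('o, 'b) ntrans \<Rightarrow> ('o, 'b) ntrans"
    ("_ \<bullet>\<^bsub>_\<^esub> _" [56, 0, 55] 55) where
  "\<beta> \<bullet>\<^bsub>D\<^esub> \<alpha> = (\<lambda>X. Comp D (\<beta> X) (\<alpha> X))"

text \<open>The whiskerings \<open>F \<lhd> \<alpha>\<close> and \<open>\<alpha> \<rhd> F\<close>, usually written \<open>F\<alpha>\<close> and \<open>\<alpha>F\<close>.\<close>

definition fctr_whisker :: "('p, 'b, 'q, 'c) fctr \<Rightarrow> ('o, 'b) ntrans \<Rightarrow> ('o, 'c) ntrans"
    (infixr "\<lhd>" 75) where
  "F \<lhd> \<alpha> = (\<lambda>X. amap F (\<alpha> X))"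

definition whisker_fctr :: "('p, 'c) ntrans \<Rightarrow> ('o, 'a, 'p, 'b) fctr \<Rightarrow> ('o, 'c) ntrans"
    (infixl "\<rhd>" 76) where
  "\<alpha> \<rhd> F = (\<lambda>X. \<alpha> (omap F X))"

definition nt_inverse :: "('o, 'a) cat \<Rightarrow> ('p, 'b) cat
    \<Rightarrow> ('o, 'a, 'p, 'b) fctr \<Rightarrow> ('o, 'a, 'p, 'b) fctr
    \<Rightarrow> ('o, 'b) ntrans \<Rightarrow> ('o, 'b) ntrans \<Rightarrow> bool" where
  "nt_inverse C D F G \<alpha> \<beta> \<longleftrightarrow>
     natural_transformation C D F G \<alpha> \<and> natural_transformation C D G F \<beta> \<and>
     nt_eq C (\<beta> \<bullet>\<^bsub>D\<^esub> \<alpha>) (id_nt D F) \<and> nt_eq C (\<alpha> \<bullet>\<^bsub>D\<^esub> \<beta>) (id_nt D G)"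

definition nt_invertible :: "('o, 'a) cat \<Rightarrow> ('p, 'b) cat
    \<Rightarrow> ('o, 'a, 'p, 'b) fctr \<Rightarrow> ('o, 'a, 'p, 'b) fctr \<Rightarrow> ('o, 'b) ntrans \<Rightarrow> bool" where
  "nt_invertible C D F G \<alpha> \<longleftrightarrow> (\<exists>\<beta>. nt_inverse C D F G \<alpha> \<beta>)"

text \<open>Two inverses agree on objects, so the choice below is unique up to \<open>nt_eq\<close>.\<close>

definition nt_inv :: "('o, 'a) cat \<Rightarrow> ('p, 'b) cat
    \<Rightarrow> ('o, 'a, 'p, 'b) fctr \<Rightarrow> ('o, 'a, 'p, 'b) fctr \<Rightarrow> ('o, 'b) ntrans \<Rightarrow> ('o, 'b) ntrans" where
  "nt_inv C D F G \<alpha> = (SOME \<beta>. nt_inverse C D F G \<alpha> \<beta>)"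

locale adjunction =
  left: cat_functor C D J + right: cat_functor D C K +
  unit: natural_transformation C C id_fctr "K \<circ>\<^sub>F J" \<eta> +
  counit: natural_transformation D D "J \<circ>\<^sub>F K" id_fctr \<epsilon>
  for C :: "('o, 'a) cat" and D :: "('p, 'b) cat"
    and J :: "('o, 'a, 'p, 'b) fctr" and K :: "('p, 'b, 'o, 'a) fctr"
    and \<eta> :: "('o, 'a) ntrans" and \<epsilon> :: "('p, 'b) ntrans" +
  assumes triangle_left: "nt_eq C ((\<epsilon> \<rhd> J) \<bullet>\<^bsub>D\<^esub> (J \<lhd> \<eta>)) (id_nt D J)"
    and triangle_right: "nt_eq D ((K \<lhd> \<epsilon>) \<bullet>\<^bsub>C\<^esub> (\<eta> \<rhd> K)) (id_nt C K)"

section \<open>The 2-category of monads in Cat\<close>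

record ('o, 'a) mnd =
  Base :: "('o, 'a) cat"
  Endo :: "('o, 'a, 'o, 'a) fctr"
  Mult :: "('o, 'a) ntrans"
  Unit :: "('o, 'a) ntrans"

locale cat_monad =
  fixes S :: "('o, 'a) mnd"
  assumes Endo_functor: "cat_functor (Base S) (Base S) (Endo S)"
    and Mult_natural:
      "natural_transformation (Base S) (Base S) (Endo S \<circ>\<^sub>F Endo S) (Endo S) (Mult S)"
    and Unit_natural: "natural_transformation (Base S) (Base S) id_fctr (Endo S) (Unit S)"
    and Mult_assoc: "nt_eq (Base S)
      (Mult S \<bullet>\<^bsub>Base S\<^esub> (Endo S \<lhd> Mult S)) (Mult S \<bullet>\<^bsub>Base S\<^esub> (Mult S \<rhd> Endo S))"
    and Unit_left: "nt_eq (Base S)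
      (Mult S \<bullet>\<^bsub>Base S\<^esub> (Unit S \<rhd> Endo S)) (id_nt (Base S) (Endo S))"
    and Unit_right: "nt_eq (Base S)
      (Mult S \<bullet>\<^bsub>Base S\<^esub> (Endo S \<lhd> Unit S)) (id_nt (Base S) (Endo S))"

text \<open>The data \<open>(B, \<psi>\<^sup>B)\<close> of a 1-cell.\<close>

record ('o, 'a, 'p, 'b) mnd_cell =
  Fun :: "('o, 'a, 'p, 'b) fctr"
  Str :: "('o, 'b) ntrans"

locale mnd_one_cell = source: cat_monad S + target: cat_monad T
  for S :: "('o, 'a) mnd" and T :: "('p, 'b) mnd" +
  fixes B :: "('o, 'a, 'p, 'b) mnd_cell"
  assumes Fun_functor: "cat_functor (Base S) (Base T) (Fun B)"
    and Str_natural: "natural_transformation (Base S) (Base T)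
      (Endo T \<circ>\<^sub>F Fun B) (Fun B \<circ>\<^sub>F Endo S) (Str B)"
    and Str_Mult: "nt_eq (Base S)
      (Str B \<bullet>\<^bsub>Base T\<^esub> (Mult T \<rhd> Fun B))
      ((Fun B \<lhd> Mult S) \<bullet>\<^bsub>Base T\<^esub> (Str B \<rhd> Endo S) \<bullet>\<^bsub>Base T\<^esub> (Endo T \<lhd> Str B))"
    and Str_Unit: "nt_eq (Base S)
      (Str B \<bullet>\<^bsub>Base T\<^esub> (Unit T \<rhd> Fun B)) (Fun B \<lhd> Unit S)"

locale mnd_two_cell = source: mnd_one_cell S T A + target: mnd_one_cell S T B
  for S :: "('o, 'a) mnd" and T :: "('p, 'b) mnd"
    and A B :: "('o, 'a, 'p, 'b) mnd_cell" +
  fixes \<theta> :: "('o, 'b) ntrans"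
  assumes natural: "natural_transformation (Base S) (Base T) (Fun A) (Fun B) \<theta>"
    and Str_compat: "nt_eq (Base S)
      (Str B \<bullet>\<^bsub>Base T\<^esub> (Endo T \<lhd> \<theta>)) ((\<theta> \<rhd> Endo S) \<bullet>\<^bsub>Base T\<^esub> Str A)"

definition mnd_id :: "('o, 'a) mnd \<Rightarrow> ('o, 'a, 'o, 'a) mnd_cell" where
  "mnd_id S = \<lparr>Fun = id_fctr, Str = id_nt (Base S) (Endo S)\<rparr>"

text \<open>\<open>mnd_comp U B A\<close> is the composite of \<open>A\<close> followed by \<open>B\<close>, where \<open>U\<close> is the target of \<open>B\<close>.\<close>

definition mnd_comp :: "('q, 'c) mnd \<Rightarrow> ('p, 'b, 'q, 'c) mnd_cell
    \<Rightarrow> ('o, 'a, 'p, 'b) mnd_cell \<Rightarrow> ('o, 'a, 'q, 'c) mnd_cell" where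
  "mnd_comp U B A =
     \<lparr>Fun = Fun B \<circ>\<^sub>F Fun A, Str = (Fun B \<lhd> Str A) \<bullet>\<^bsub>Base U\<^esub> (Str B \<rhd> Fun A)\<rparr>"

locale adjoint_object =
  left: mnd_one_cell S T J + right: mnd_one_cell T S K +
  unit: mnd_two_cell S S "mnd_id S" "mnd_comp S K J" \<eta> +
  counit: mnd_two_cell T T "mnd_comp T J K" "mnd_id T" \<epsilon>
  for S :: "('o, 'a) mnd" and T :: "('p, 'b) mnd"
    and J :: "('o, 'a, 'p, 'b) mnd_cell" and K :: "('p, 'b, 'o, 'a) mnd_cell"
    and \<eta> :: "('o, 'a) ntrans" and \<epsilon> :: "('p, 'b) ntrans" +
  assumes triangle_left: "nt_eq (Base S)
      ((\<epsilon> \<rhd> Fun J) \<bullet>\<^bsub>Base T\<^esub> (Fun J \<lhd> \<eta>)) (id_nt (Base T) (Fun J))"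
    and triangle_right: "nt_eq (Base T)
      ((Fun K \<lhd> \<epsilon>) \<bullet>\<^bsub>Base S\<^esub> (\<eta> \<rhd> Fun K)) (id_nt (Base S) (Fun K))"

text \<open>\<open>ad(\<psi>\<^sup>J) = KT\<epsilon> \<circ> K(\<psi>\<^sup>J)\<^sup>-\<^sup>1K \<circ> \<eta>SK\<close>; meaningful only if \<open>\<psi>\<^sup>J : TJ \<rightarrow> JS\<close> is invertible.\<close>

definition ad :: "('o, 'a) mnd \<Rightarrow> ('p, 'b) mnd
    \<Rightarrow> ('o, 'a, 'p, 'b) fctr \<Rightarrow> ('p, 'b, 'o, 'a) fctr
    \<Rightarrow> ('o, 'a) ntrans \<Rightarrow> ('p, 'b) ntrans \<Rightarrow> ('o, 'b) ntrans \<Rightarrow> ('p, 'a) ntrans" where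
  "ad S T J K \<eta> \<epsilon> \<psi> =
     (K \<lhd> Endo T \<lhd> \<epsilon>) \<bullet>\<^bsub>Base S\<^esub>
     (K \<lhd> (nt_inv (Base S) (Base T) (Endo T \<circ>\<^sub>F J) (J \<circ>\<^sub>F Endo S) \<psi> \<rhd> K)) \<bullet>\<^bsub>Base S\<^esub>
     (\<eta> \<rhd> (Endo S \<circ>\<^sub>F K))"

end

theory Submission
  imports Defs
begin

text \<open>
  The adjunction makes a morphism \<open>f : X \<rightarrow> KY\<close> determined by its transpose \<open>\<epsilon>Y \<circ> Jf\<close>. If \<open>\<chi>\<close> is
  inverse to \<open>\<psi>\<^sup>J\<close>, then the transpose of \<open>ad(\<psi>\<^sup>J)\<close> is \<open>T\<epsilon> \<circ> \<chi>K\<close>, and every axiom of an adjoint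
  object becomes, after transposition, an axiom for \<open>\<psi>\<^sup>J\<close> read backwards. Conversely, compatibility
  of \<open>\<epsilon>\<close> with the structure maps says exactly that \<open>\<epsilon>T \<circ> J\<psi>\<^sup>K \<circ> \<psi>\<^sup>JK = T\<epsilon>\<close>. This forces the
  transpose of \<open>\<psi>\<^sup>K\<close>, and it makes the mate \<open>\<epsilon>TJ \<circ> J\<psi>\<^sup>KJ \<circ> JS\<eta>\<close> a left inverse of \<open>\<psi>\<^sup>J\<close>; the same
  condition for \<open>\<eta>\<close> makes it a right inverse.
\<close>

section \<open>Categories, functors and natural transformations\<close>

text \<open>
  Typing conditions are restated with \<open>Arr\<close>, \<open>Dom\<close> and \<open>Cod\<close>, which the simplifier can compute,
  unlike the intermediate objects in the premises about \<open>Hom\<close>.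
\<close>

lemma Hom_iff: "f \<in> Hom C X Y \<longleftrightarrow> f \<in> Arr C \<and> Dom C f = X \<and> Cod C f = Y"
  by (simp add: Hom_def)

lemma fcomp_simps [simp]:
  "omap (G \<circ>\<^sub>F F) X = omap G (omap F X)"
  "amap (G \<circ>\<^sub>F F) f = amap G (amap F f)"
  by (simp_all add: fcomp_def)

lemma id_fctr_simps [simp]:
  "omap id_fctr X = X"
  "amap id_fctr f = f"
  by (simp_all add: id_fctr_def)

lemmas nt_defs = nt_eq_def vcomp_def id_nt_def fctr_whisker_def whisker_fctr_def

context category
begin

lemma Ident_simps [simp]:
  assumes "X \<in> Obj C"
  shows "Ident C X \<in> Arr C" "Dom C (Ident C X) = X" "Cod C (Ident C X) = X"
  using Ident_Hom[OF assms] by (simp_all add: Hom_iff)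

lemma Obj_simps [simp]:
  "f \<in> Arr C \<Longrightarrow> Dom C f \<in> Obj C"
  "f \<in> Arr C \<Longrightarrow> Cod C f \<in> Obj C"
  by (simp_all add: Dom_Obj Cod_Obj)

lemma Comp_simps [simp]:
  assumes "f \<in> Arr C" "g \<in> Arr C" "Cod C f = Dom C g"
  shows "Comp C g f \<in> Arr C" "Dom C (Comp C g f) = Dom C f" "Cod C (Comp C g f) = Cod C g"
  using Comp_Hom[of f "Dom C f" "Cod C f" g "Cod C g"] assms by (simp_all add: Hom_iff)

lemma Comp_Ident_simps [simp]:
  "f \<in> Arr C \<Longrightarrow> Dom C f = X \<Longrightarrow> Comp C f (Ident C X) = f"
  "f \<in> Arr C \<Longrightarrow> Cod C f = X \<Longrightarrow> Comp C (Ident C X) f = f"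
  using Comp_Ident_right Comp_Ident_left by (auto simp: Hom_iff)

text \<open>As a simp rule this nests every composite to the right, so an equation between short
  composites no longer matches inside a longer one. The next two lemmas, and later those named with
  the suffix \<open>_Comp\<close>, restate such equations with a trailing arrow
  \<open>x\<close>.\<close>

lemma Comp_assoc_right [simp]:
  "\<lbrakk>f \<in> Arr C; g \<in> Arr C; h \<in> Arr C; Cod C f = Dom C g; Cod C g = Dom C h\<rbrakk>
    \<Longrightarrow> Comp C (Comp C h g) f = Comp C h (Comp C g f)"
  using Comp_assoc by (simp add: Hom_iff)

lemma Comp_eq_Comp:
  assumes "Comp C g f = Comp C k h"
    and "f \<in> Arr C" "g \<in> Arr C" "h \<in> Arr C" "k \<in> Arr C" "x \<in> Arr C"
    and "Cod C f = Dom C g" "Cod C h = Dom C k" "Cod C x = Dom C f" "Cod C x = Dom C h"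
  shows "Comp C g (Comp C f x) = Comp C k (Comp C h x)"
  using assms by (metis Comp_assoc_right)

lemma Comp_eq_cancel:
  assumes "Comp C g f = h"
    and "f \<in> Arr C" "g \<in> Arr C" "x \<in> Arr C" "Cod C f = Dom C g" "Cod C x = Dom C f"
  shows "Comp C g (Comp C f x) = Comp C h x"
  using assms by (metis Comp_assoc_right)

end

context cat_functor
begin

lemma omap_simp [simp]: "X \<in> Obj C \<Longrightarrow> omap F X \<in> Obj D"
  by (rule omap_Obj)

lemma amap_simps [simp]:
  assumes "f \<in> Arr C"
  shows "amap F f \<in> Arr D" "Dom D (amap F f) = omap F (Dom C f)"
    "Cod D (amap F f) = omap F (Cod C f)"
  using amap_Hom[of f "Dom C f" "Cod C f"] assms by (simp_all add: Hom_iff)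

lemma amap_Ident_simp [simp]: "X \<in> Obj C \<Longrightarrow> amap F (Ident C X) = Ident D (omap F X)"
  by (rule amap_Ident)

lemma amap_Comp_simp [simp]:
  "\<lbrakk>f \<in> Arr C; g \<in> Arr C; Cod C f = Dom C g\<rbrakk>
    \<Longrightarrow> amap F (Comp C g f) = Comp D (amap F g) (amap F f)"
  using amap_Comp by (simp add: Hom_iff)

end

context natural_transformation
begin

lemma component_simps [simp]:
  assumes "X \<in> Obj C"
  shows "\<alpha> X \<in> Arr D" "Dom D (\<alpha> X) = omap F X" "Cod D (\<alpha> X) = omap G X"
  using component[OF assms] by (simp_all add: Hom_iff)

lemma naturality_Arr:
  "\<lbrakk>f \<in> Arr C; Dom C f = X; Cod C f = Y\<rbrakk> \<Longrightarrow> Comp D (\<alpha> Y) (amap F f) = Comp D (amap G f) (\<alpha> X)"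
  by (rule naturality) (simp add: Hom_iff)

lemma naturality_Comp:
  assumes "f \<in> Arr C" "Dom C f = X" "Cod C f = Y" "x \<in> Arr D" "Cod D x = omap F X"
  shows "Comp D (\<alpha> Y) (Comp D (amap F f) x) = Comp D (amap G f) (Comp D (\<alpha> X) x)"
  using assms by (intro source.target.Comp_eq_Comp naturality_Arr) auto

end

text \<open>Inverting the naturality square of \<open>\<alpha>\<close> at each component yields that
  of \<open>\<beta>\<close>, so an inverse can be specified by its components alone.\<close>

lemma nt_inverse_componentwise:
  assumes "natural_transformation C D F G \<alpha>"
    and \<beta>: "\<And>X. X \<in> Obj C \<Longrightarrow> \<beta> X \<in> Hom D (omap G X) (omap F X)"
    and left: "\<And>X. X \<in> Obj C \<Longrightarrow> Comp D (\<beta> X) (\<alpha> X) = Ident D (omap F X)"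
    and right: "\<And>X. X \<in> Obj C \<Longrightarrow> Comp D (\<alpha> X) (\<beta> X) = Ident D (omap G X)"
  shows "nt_inverse C D F G \<alpha> \<beta>"
proof -
  interpret \<alpha>: natural_transformation C D F G \<alpha> by fact
  have [simp]: "\<beta> X \<in> Arr D" "Dom D (\<beta> X) = omap G X" "Cod D (\<beta> X) = omap F X"
    if "X \<in> Obj C" for X
    using \<beta>[OF that] by (simp_all add: Hom_iff)
  have "natural_transformation C D G F \<beta>"
  proof
    fix f X Y assume "f \<in> Hom C X Y"
    then have f [simp]: "f \<in> Arr C" "Dom C f = X" "Cod C f = Y" by (simp_all add: Hom_iff)
    have [simp]: "X \<in> Obj C" "Y \<in> Obj C"
      using \<alpha>.source.source.Obj_simps[OF f(1)] by simp_all
    \<comment> \<open>Inserting the identity \<open>\<alpha> X\<close> after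
      \<open>\<beta> X\<close> on the right makes naturality of \<open>\<alpha>\<close>
      applicable.\<close>
    have "Comp D (\<beta> Y) (amap G f) = Comp D (\<beta> Y) (Comp D (amap G f) (Comp D (\<alpha> X) (\<beta> X)))"
      by (simp add: right)
    also have "\<dots> = Comp D (\<beta> Y) (Comp D (\<alpha> Y) (Comp D (amap F f) (\<beta> X)))"
      by (simp add: \<alpha>.naturality_Comp)
    also have "\<dots> = Comp D (amap F f) (\<beta> X)"
      by (subst \<alpha>.source.target.Comp_eq_cancel[OF left]) simp_all
    finally show "Comp D (\<beta> Y) (amap G f) = Comp D (amap F f) (\<beta> X)" .
  qed (rule \<beta>)
  then show ?thesis
    unfolding nt_inverse_def using left right by (simp add: nt_defs \<alpha>.natural_transformation_axioms)
qed

lemma nt_inverse_nt_inv: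
  assumes "nt_inverse C D F G \<alpha> \<beta>"
  shows "nt_inverse C D F G \<alpha> (nt_inv C D F G \<alpha>)"
  unfolding nt_inv_def by (rule someI[of _ \<beta>]) (fact assms)

section \<open>Identity and composite 1-cells\<close>

text \<open>A 2-cell presupposes that its source and target are 1-cells; the unit and counit of an
  adjoint object need this for identities and composites.\<close>

lemma mnd_id_one_cell:
  assumes "cat_monad S"
  shows "mnd_one_cell S S (mnd_id S)"
proof -
  interpret cat_monad S by fact
  interpret Endo: cat_functor "Base S" "Base S" "Endo S" by (rule Endo_functor)
  interpret Mult: natural_transformation "Base S" "Base S" "Endo S \<circ>\<^sub>F Endo S" "Endo S" "Mult S"
    by (rule Mult_natural)
  interpret Unit: natural_transformation "Base S" "Base S" id_fctr "Endo S" "Unit S"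
    by (rule Unit_natural)
  show ?thesis
    by unfold_locales (auto simp: mnd_id_def nt_defs Hom_iff)
qed

context mnd_one_cell
begin

lemma Str_Mult_component:
  "X \<in> Obj (Base S) \<Longrightarrow> Comp (Base T) (Str B X) (Mult T (omap (Fun B) X)) =
    Comp (Base T) (amap (Fun B) (Mult S X))
      (Comp (Base T) (Str B (omap (Endo S) X)) (amap (Endo T) (Str B X)))"
  using Str_Mult by (simp add: nt_defs)

lemma Str_Unit_component:
  "X \<in> Obj (Base S) \<Longrightarrow>
    Comp (Base T) (Str B X) (Unit T (omap (Fun B) X)) = amap (Fun B) (Unit S X)"
  using Str_Unit by (simp add: nt_defs)

end

text \<open>Each axiom is the one for \<open>B\<close> pasted with the image under
  \<open>Fun B\<close> of the one for \<open>A\<close>. For multiplication the two are linked by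
  naturality of \<open>Str B\<close>.\<close>

lemma mnd_comp_one_cell:
  assumes "mnd_one_cell S T A" "mnd_one_cell T U B"
  shows "mnd_one_cell S U (mnd_comp U B A)"
proof -
  interpret A: mnd_one_cell S T A by fact
  interpret B: mnd_one_cell T U B by fact
  interpret FA: cat_functor "Base S" "Base T" "Fun A" by (rule A.Fun_functor)
  interpret FB: cat_functor "Base T" "Base U" "Fun B" by (rule B.Fun_functor)
  interpret ES: cat_functor "Base S" "Base S" "Endo S" by (rule A.source.Endo_functor)
  interpret ET: cat_functor "Base T" "Base T" "Endo T" by (rule A.target.Endo_functor)
  interpret EU: cat_functor "Base U" "Base U" "Endo U" by (rule B.target.Endo_functor)
  interpret MS: natural_transformation "Base S" "Base S" "Endo S \<circ>\<^sub>F Endo S" "Endo S" "Mult S"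
    by (rule A.source.Mult_natural)
  interpret MT: natural_transformation "Base T" "Base T" "Endo T \<circ>\<^sub>F Endo T" "Endo T" "Mult T"
    by (rule A.target.Mult_natural)
  interpret MU: natural_transformation "Base U" "Base U" "Endo U \<circ>\<^sub>F Endo U" "Endo U" "Mult U"
    by (rule B.target.Mult_natural)
  interpret US: natural_transformation "Base S" "Base S" id_fctr "Endo S" "Unit S"
    by (rule A.source.Unit_natural)
  interpret UT: natural_transformation "Base T" "Base T" id_fctr "Endo T" "Unit T"
    by (rule A.target.Unit_natural)
  interpret UU: natural_transformation "Base U" "Base U" id_fctr "Endo U" "Unit U"
    by (rule B.target.Unit_natural)
  interpret SA: natural_transformation "Base S" "Base T" "Endo T \<circ>\<^sub>F Fun A" "Fun A \<circ>\<^sub>F Endo S" "Str A"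
    by (rule A.Str_natural)
  interpret SB: natural_transformation "Base T" "Base U" "Endo U \<circ>\<^sub>F Fun B" "Fun B \<circ>\<^sub>F Endo T" "Str B"
    by (rule B.Str_natural)
  have SA_nat: "Comp (Base T) (Str A Y) (amap (Endo T) (amap (Fun A) f)) =
      Comp (Base T) (amap (Fun A) (amap (Endo S) f)) (Str A X)"
    if "f \<in> Hom (Base S) X Y" for f X Y
    using SA.naturality[OF that] by simp
  have SB_nat: "Comp (Base U) (Str B (Cod (Base T) f)) (amap (Endo U) (amap (Fun B) f)) =
      Comp (Base U) (amap (Fun B) (amap (Endo T) f)) (Str B (Dom (Base T) f))"
    if "f \<in> Arr (Base T)" for f
    using SB.naturality_Arr[OF that refl refl] by simp
  show ?thesis
  proof unfold_locales
    fix f X Y assume f: "f \<in> Hom (Base S) X Y"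
    then have [simp]: "f \<in> Arr (Base S)" "Dom (Base S) f = X" "Cod (Base S) f = Y"
      by (simp_all add: Hom_iff)
    have [simp]: "X \<in> Obj (Base S)" "Y \<in> Obj (Base S)"
      using FA.source.Obj_simps[of f] by simp_all
    have "Comp (Base U) (amap (Fun B) (Str A Y))
        (Comp (Base U) (Str B (omap (Fun A) Y)) (amap (Endo U) (amap (Fun B) (amap (Fun A) f)))) =
      Comp (Base U) (amap (Fun B) (Str A Y))
        (Comp (Base U) (amap (Fun B) (amap (Endo T) (amap (Fun A) f))) (Str B (omap (Fun A) X)))"
      using SB_nat[of "amap (Fun A) f"] by simp
    also have "\<dots> = Comp (Base U)
        (amap (Fun B) (Comp (Base T) (Str A Y) (amap (Endo T) (amap (Fun A) f))))
        (Str B (omap (Fun A) X))"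
      by simp
    also have "\<dots> = Comp (Base U) (amap (Fun B) (amap (Fun A) (amap (Endo S) f)))
        (Comp (Base U) (amap (Fun B) (Str A X)) (Str B (omap (Fun A) X)))"
      by (simp add: SA_nat[OF f])
    finally show "Comp (Base U) (Str (mnd_comp U B A) Y)
        (amap (Endo U \<circ>\<^sub>F Fun (mnd_comp U B A)) f) =
      Comp (Base U) (amap (Fun (mnd_comp U B A) \<circ>\<^sub>F Endo S) f) (Str (mnd_comp U B A) X)"
      by (simp add: mnd_comp_def nt_defs)
  next
    show "nt_eq (Base S)
      (Str (mnd_comp U B A) \<bullet>\<^bsub>Base U\<^esub> (Mult U \<rhd> Fun (mnd_comp U B A)))
      ((Fun (mnd_comp U B A) \<lhd> Mult S) \<bullet>\<^bsub>Base U\<^esub> (Str (mnd_comp U B A) \<rhd> Endo S) \<bullet>\<^bsub>Base U\<^esub>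
        (Endo U \<lhd> Str (mnd_comp U B A)))"
      unfolding nt_eq_def
    proof
      fix X assume [simp]: "X \<in> Obj (Base S)"
      let ?c = "Comp (Base U)" and ?A = "Str A" and ?B = "Str B"
      let ?a = "omap (Fun A)" and ?s = "omap (Endo S)"
      have "?c (amap (Fun B) (?A X)) (?c (?B (?a X)) (Mult U (omap (Fun B) (?a X)))) =
        ?c (amap (Fun B) (Comp (Base T) (?A X) (Mult T (?a X))))
          (?c (?B (omap (Endo T) (?a X))) (amap (Endo U) (?B (?a X))))"
        by (simp add: B.Str_Mult_component)
      also have "\<dots> = ?c (amap (Fun B) (amap (Fun A) (Mult S X)))
        (?c (amap (Fun B) (?A (?s X))) (?c (amap (Fun B) (amap (Endo T) (?A X)))
          (?c (?B (omap (Endo T) (?a X))) (amap (Endo U) (?B (?a X))))))"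
        \<comment> \<open>Functoriality is withheld so that the composite under \<open>Fun B\<close>
          stays in one piece for the axiom of \<open>A\<close>; the second call then distributes
          \<open>Fun B\<close>. The same device recurs below.\<close>
        by (simp add: A.Str_Mult_component del: FB.amap_Comp_simp)
          simp
      \<comment> \<open>Interchange: \<open>Str B\<close> is natural at the arrow
        \<open>Str A X\<close>.\<close>
      also have "?c (amap (Fun B) (amap (Endo T) (?A X)))
          (?c (?B (omap (Endo T) (?a X))) (amap (Endo U) (?B (?a X)))) =
        ?c (?B (?a (?s X))) (?c (amap (Endo U) (amap (Fun B) (?A X))) (amap (Endo U) (?B (?a X))))"
        by (rule FB.target.Comp_eq_Comp) (use SB_nat[of "?A X"] in simp_all)
      finally show "(Str (mnd_comp U B A) \<bullet>\<^bsub>Base U\<^esub> (Mult U \<rhd> Fun (mnd_comp U B A))) X =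
        ((Fun (mnd_comp U B A) \<lhd> Mult S) \<bullet>\<^bsub>Base U\<^esub> (Str (mnd_comp U B A) \<rhd> Endo S) \<bullet>\<^bsub>Base U\<^esub>
        (Endo U \<lhd> Str (mnd_comp U B A))) X"
        by (simp add: mnd_comp_def nt_defs)
    qed
  next
    show "nt_eq (Base S) (Str (mnd_comp U B A) \<bullet>\<^bsub>Base U\<^esub> (Unit U \<rhd> Fun (mnd_comp U B A)))
        (Fun (mnd_comp U B A) \<lhd> Unit S)"
      \<comment> \<open>Functoriality is used backwards: after the unit axiom of \<open>B\<close>,
        both factors lie under \<open>Fun B\<close> and are gathered for the unit axiom of
        \<open>A\<close>.\<close>
      by (simp add: mnd_comp_def nt_defs B.Str_Unit_component A.Str_Unit_component
          flip: FB.amap_Comp_simp)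
  qed (auto simp: mnd_comp_def nt_defs Hom_iff)
qed

section \<open>Adjoint objects over a given adjunction\<close>

locale adjunction_one_cell =
  adj: adjunction "Base S" "Base T" J K \<eta> \<epsilon> + cell: mnd_one_cell S T "\<lparr>Fun = J, Str = \<psi>\<rparr>"
  for S :: "('o, 'a) mnd" and T :: "('p, 'b) mnd"
    and J :: "('o, 'a, 'p, 'b) fctr" and K :: "('p, 'b, 'o, 'a) fctr"
    and \<eta> :: "('o, 'a) ntrans" and \<epsilon> :: "('p, 'b) ntrans" and \<psi> :: "('o, 'b) ntrans"
begin

abbreviation compS (infixr "\<cdot>" 55) where "g \<cdot> f \<equiv> Comp (Base S) g f"
abbreviation compT (infixr "\<star>" 55) where "g \<star> f \<equiv> Comp (Base T) g f"

sublocale ES: cat_functor "Base S" "Base S" "Endo S" by (rule cell.source.Endo_functor)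
sublocale ET: cat_functor "Base T" "Base T" "Endo T" by (rule cell.target.Endo_functor)
sublocale MS: natural_transformation "Base S" "Base S" "Endo S \<circ>\<^sub>F Endo S" "Endo S" "Mult S"
  by (rule cell.source.Mult_natural)
sublocale MT: natural_transformation "Base T" "Base T" "Endo T \<circ>\<^sub>F Endo T" "Endo T" "Mult T"
  by (rule cell.target.Mult_natural)
sublocale US: natural_transformation "Base S" "Base S" id_fctr "Endo S" "Unit S"
  by (rule cell.source.Unit_natural)
sublocale UT: natural_transformation "Base T" "Base T" id_fctr "Endo T" "Unit T"
  by (rule cell.target.Unit_natural)
sublocale \<psi>: natural_transformation "Base S" "Base T" "Endo T \<circ>\<^sub>F J" "J \<circ>\<^sub>F Endo S" \<psi>
  using cell.Str_natural by simp

section \<open>Transposition across the adjunction\<close>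

lemma triangle_left [simp]:
  "X \<in> Obj (Base S) \<Longrightarrow> \<epsilon> (omap J X) \<star> amap J (\<eta> X) = Ident (Base T) (omap J X)"
  using adj.triangle_left by (simp add: nt_defs)

lemma triangle_right:
  "Y \<in> Obj (Base T) \<Longrightarrow> amap K (\<epsilon> Y) \<cdot> \<eta> (omap K Y) = Ident (Base S) (omap K Y)"
  using adj.triangle_right by (simp add: nt_defs)

lemma counit_natural:
  "\<lbrakk>f \<in> Arr (Base T); Dom (Base T) f = X; Cod (Base T) f = Y\<rbrakk>
    \<Longrightarrow> \<epsilon> Y \<star> amap J (amap K f) = f \<star> \<epsilon> X"
  using adj.counit.naturality_Arr by simp

lemma counit_natural_Comp:
  "\<lbrakk>f \<in> Arr (Base T); Dom (Base T) f = X; Cod (Base T) f = Y; x \<in> Arr (Base T);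
    Cod (Base T) x = omap J (omap K X)\<rbrakk>
    \<Longrightarrow> \<epsilon> Y \<star> amap J (amap K f) \<star> x = f \<star> \<epsilon> X \<star> x"
  using adj.counit.naturality_Comp by simp

text \<open>Naturality of \<open>\<eta>\<close> carries \<open>f\<close> out from under
  \<open>K\<close> and \<open>J\<close>; the right triangle cancels what remains.\<close>

lemma transpose_inverse:
  assumes [simp]: "f \<in> Hom (Base S) X (omap K Y)" "X \<in> Obj (Base S)" "Y \<in> Obj (Base T)"
  shows "amap K (\<epsilon> Y \<star> amap J f) \<cdot> \<eta> X = f"
proof -
  have [simp]: "f \<in> Arr (Base S)" "Dom (Base S) f = X" "Cod (Base S) f = omap K Y"
    using assms(1) by (simp_all only: Hom_iff)
  have "amap K (\<epsilon> Y \<star> amap J f) \<cdot> \<eta> X = amap K (\<epsilon> Y) \<cdot> \<eta> (omap K Y) \<cdot> f"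
    using adj.unit.naturality_Arr[of f X "omap K Y"] by simp
  also have "\<dots> = f"
    by (subst adj.left.source.Comp_eq_cancel[OF triangle_right]) simp_all
  finally show ?thesis .
qed

text \<open>The means of proving equations between arrows into \<open>omap K Y\<close>: it serves
  both for the axioms of \<open>ad\<close> and for its uniqueness.\<close>

lemma transpose_inject:
  assumes "\<epsilon> Y \<star> amap J f = \<epsilon> Y \<star> amap J g"
    and "f \<in> Hom (Base S) X (omap K Y)" "g \<in> Hom (Base S) X (omap K Y)"
    and "X \<in> Obj (Base S)" "Y \<in> Obj (Base T)"
  shows "f = g"
  using assms transpose_inverse by metis

end

section \<open>From an invertible structure map to an adjoint object\<close>

locale invertible_adjunction_one_cell = adjunction_one_cell S T J K \<eta> \<epsilon> \<psi>
  for S :: "('o, 'a) mnd" and T :: "('p, 'b) mnd"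
    and J :: "('o, 'a, 'p, 'b) fctr" and K :: "('p, 'b, 'o, 'a) fctr"
    and \<eta> :: "('o, 'a) ntrans" and \<epsilon> :: "('p, 'b) ntrans" and \<psi> :: "('o, 'b) ntrans" +
  assumes invertible: "nt_invertible (Base S) (Base T) (Endo T \<circ>\<^sub>F J) (J \<circ>\<^sub>F Endo S) \<psi>"
begin

text \<open>The same chosen inverse that occurs in \<open>ad\<close>, so unfolding \<open>ad\<close>
  exposes \<open>\<chi>\<close>.\<close>

definition \<chi> where "\<chi> = nt_inv (Base S) (Base T) (Endo T \<circ>\<^sub>F J) (J \<circ>\<^sub>F Endo S) \<psi>"

lemma \<chi>_inverse: "nt_inverse (Base S) (Base T) (Endo T \<circ>\<^sub>F J) (J \<circ>\<^sub>F Endo S) \<psi> \<chi>"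
  using invertible nt_inverse_nt_inv unfolding nt_invertible_def \<chi>_def by blast

sublocale \<chi>: natural_transformation "Base S" "Base T" "J \<circ>\<^sub>F Endo S" "Endo T \<circ>\<^sub>F J" \<chi>
  using \<chi>_inverse by (simp add: nt_inverse_def)

lemma \<chi>_\<psi>: "X \<in> Obj (Base S) \<Longrightarrow> \<chi> X \<star> \<psi> X = Ident (Base T) (omap (Endo T) (omap J X))"
  and \<psi>_\<chi>: "X \<in> Obj (Base S) \<Longrightarrow> \<psi> X \<star> \<chi> X = Ident (Base T) (omap J (omap (Endo S) X))"
  using \<chi>_inverse by (simp_all add: nt_inverse_def nt_defs)

lemma \<chi>_\<psi>_Comp:
  assumes "X \<in> Obj (Base S)" "x \<in> Arr (Base T)" "Cod (Base T) x = omap (Endo T) (omap J X)"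
  shows "\<chi> X \<star> \<psi> X \<star> x = x"
  using assms by (subst adj.left.target.Comp_eq_cancel[OF \<chi>_\<psi>]) simp_all

text \<open>The unit axiom of \<open>\<psi>\<close> composed with \<open>\<chi>\<close> on the
  left.\<close>

lemma \<chi>_Unit:
  assumes [simp]: "X \<in> Obj (Base S)"
  shows "\<chi> X \<star> amap J (Unit S X) = Unit T (omap J X)"
  using cell.Str_Unit_component[of X, symmetric] by (simp add: \<chi>_\<psi>_Comp)

lemma \<chi>_Mult:
  assumes [simp]: "X \<in> Obj (Base S)"
  shows "\<chi> X \<star> amap J (Mult S X) =
    Mult T (omap J X) \<star> amap (Endo T) (\<chi> X) \<star> \<chi> (omap (Endo S) X)"
proof -
  let ?s = "omap (Endo S)"
  \<comment> \<open>An identity is inserted on the right, as \<open>\<psi>\<close> at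
    \<open>?s X\<close> followed on either side by its inverse, with a second identity under
    \<open>Endo T\<close>; this creates the right-hand side of the multiplication axiom of
    \<open>\<psi>\<close>.\<close>
  have "\<chi> X \<star> amap J (Mult S X) = \<chi> X \<star> amap J (Mult S X) \<star> \<psi> (?s X) \<star>
      amap (Endo T) (\<psi> X \<star> \<chi> X) \<star> \<chi> (?s X)"
    by (simp add: \<psi>_\<chi> del: ET.amap_Comp_simp)
  also have "\<dots> = \<chi> X \<star> (amap J (Mult S X) \<star> \<psi> (?s X) \<star> amap (Endo T) (\<psi> X)) \<star>
      amap (Endo T) (\<chi> X) \<star> \<chi> (?s X)"
    by simp
  also have "amap J (Mult S X) \<star> \<psi> (?s X) \<star> amap (Endo T) (\<psi> X) = \<psi> X \<star> Mult T (omap J X)"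
    using cell.Str_Mult_component[of X] by simp
  finally show ?thesis by (simp add: \<chi>_\<psi>_Comp)
qed

abbreviation \<phi> where "\<phi> \<equiv> ad S T J K \<eta> \<epsilon> \<psi>"

lemma ad_component:
  "\<phi> Y = amap K (amap (Endo T) (\<epsilon> Y)) \<cdot> amap K (\<chi> (omap K Y)) \<cdot> \<eta> (omap (Endo S) (omap K Y))"
  by (simp add: ad_def nt_defs \<chi>_def)

lemma ad_simps [simp]:
  assumes "Y \<in> Obj (Base T)"
  shows "\<phi> Y \<in> Arr (Base S)" "Dom (Base S) (\<phi> Y) = omap (Endo S) (omap K Y)"
    "Cod (Base S) (\<phi> Y) = omap K (omap (Endo T) Y)"
  using assms by (simp_all add: ad_component)

text \<open>Naturality of \<open>\<epsilon>\<close> strips \<open>J\<close> and \<open>K\<close>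
  from the two left factors of \<open>ad\<close>, and the left triangle removes
  \<open>\<eta>\<close>.\<close>

lemma transpose_ad:
  assumes [simp]: "Y \<in> Obj (Base T)"
  shows "\<epsilon> (omap (Endo T) Y) \<star> amap J (\<phi> Y) = amap (Endo T) (\<epsilon> Y) \<star> \<chi> (omap K Y)"
  by (simp add: ad_component counit_natural_Comp)

lemma transpose_ad_Comp:
  assumes [simp]: "Y \<in> Obj (Base T)" "x \<in> Arr (Base T)"
    "Cod (Base T) x = omap J (omap (Endo S) (omap K Y))"
  shows "\<epsilon> (omap (Endo T) Y) \<star> amap J (\<phi> Y) \<star> x = amap (Endo T) (\<epsilon> Y) \<star> \<chi> (omap K Y) \<star> x"
  by (subst adj.left.target.Comp_eq_Comp[OF transpose_ad]) simp_all

text \<open>Cancelling \<open>\<psi>\<close> on the right of the counit condition leaves the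
  transpose of \<open>\<psi>K\<close>, which agrees with \<open>transpose_ad\<close>.\<close>

lemma ad_unique:
  assumes "adjoint_object S T \<lparr>Fun = J, Str = \<psi>\<rparr> \<lparr>Fun = K, Str = \<psi>K\<rparr> \<eta> \<epsilon>"
  shows "nt_eq (Base T) \<psi>K \<phi>"
  unfolding nt_eq_def
proof
  fix Y assume [simp]: "Y \<in> Obj (Base T)"
  interpret A: adjoint_object S T "\<lparr>Fun = J, Str = \<psi>\<rparr>" "\<lparr>Fun = K, Str = \<psi>K\<rparr>" \<eta> \<epsilon> by fact
  interpret \<psi>K: natural_transformation "Base T" "Base S" "Endo S \<circ>\<^sub>F K" "K \<circ>\<^sub>F Endo T" \<psi>K
    using A.right.Str_natural by simp
  have "\<epsilon> (omap (Endo T) Y) \<star> amap J (\<psi>K Y) \<star> \<psi> (omap K Y) = amap (Endo T) (\<epsilon> Y)"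
    using A.counit.Str_compat by (simp add: nt_defs mnd_comp_def mnd_id_def)
  then have "amap (Endo T) (\<epsilon> Y) \<star> \<chi> (omap K Y) =
      (\<epsilon> (omap (Endo T) Y) \<star> amap J (\<psi>K Y) \<star> \<psi> (omap K Y)) \<star> \<chi> (omap K Y)"
    by simp
  also have "\<dots> = \<epsilon> (omap (Endo T) Y) \<star> amap J (\<psi>K Y)"
    by (simp add: \<psi>_\<chi>)
  finally show "\<psi>K Y = \<phi> Y"
    by (intro transpose_inject[of "omap (Endo T) Y" _ _ "omap (Endo S) (omap K Y)"])
      (simp_all add: transpose_ad Hom_iff)
qed

text \<open>Both sides of the square have the same transpose, by naturality of \<open>\<chi>\<close>
  at \<open>amap K f\<close> and of \<open>\<epsilon>\<close> at \<open>f\<close>, the latter under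
  \<open>Endo T\<close>.\<close>

lemma ad_natural: "natural_transformation (Base T) (Base S) (Endo S \<circ>\<^sub>F K) (K \<circ>\<^sub>F Endo T) \<phi>"
proof
  fix f X Y assume "f \<in> Hom (Base T) X Y"
  then have f [simp]: "f \<in> Arr (Base T)" "Dom (Base T) f = X" "Cod (Base T) f = Y"
    by (simp_all add: Hom_iff)
  have [simp]: "X \<in> Obj (Base T)" "Y \<in> Obj (Base T)"
    using adj.left.target.Obj_simps[OF f(1)] by simp_all
  let ?T = "amap (Endo T)"
  have "\<epsilon> (omap (Endo T) Y) \<star> amap J (\<phi> Y \<cdot> amap (Endo S) (amap K f)) =
      ?T (\<epsilon> Y) \<star> \<chi> (omap K Y) \<star> amap J (amap (Endo S) (amap K f))"
    by (simp add: transpose_ad_Comp)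
  also have "\<dots> = ?T (\<epsilon> Y \<star> amap J (amap K f)) \<star> \<chi> (omap K X)"
    using \<chi>.naturality_Arr[of "amap K f"] by simp
  also have "\<dots> = ?T f \<star> ?T (\<epsilon> X) \<star> \<chi> (omap K X)"
    by (simp add: counit_natural del: ET.amap_Comp_simp) simp
  also have "\<dots> = \<epsilon> (omap (Endo T) Y) \<star> amap J (amap K (?T f) \<cdot> \<phi> X)"
    by (simp add: counit_natural_Comp transpose_ad)
  finally have "\<phi> Y \<cdot> amap (Endo S) (amap K f) = amap K (?T f) \<cdot> \<phi> X"
    by (rule transpose_inject[of _ _ _ "omap (Endo S) (omap K X)"]) (simp_all add: Hom_iff)
  then show "\<phi> Y \<cdot> amap (Endo S \<circ>\<^sub>F K) f = amap (K \<circ>\<^sub>F Endo T) f \<cdot> \<phi> X"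
    by simp
qed (auto simp: Hom_iff)

text \<open>After transposition, \<open>\<chi>_Unit\<close> replaces \<open>Unit S\<close> by
  \<open>Unit T\<close>, whose naturality at \<open>\<epsilon> Y\<close> concludes.\<close>

lemma ad_Unit:
  assumes [simp]: "Y \<in> Obj (Base T)"
  shows "\<phi> Y \<cdot> Unit S (omap K Y) = amap K (Unit T Y)"
proof (rule transpose_inject)
  show "\<epsilon> (omap (Endo T) Y) \<star> amap J (\<phi> Y \<cdot> Unit S (omap K Y)) =
      \<epsilon> (omap (Endo T) Y) \<star> amap J (amap K (Unit T Y))"
    using UT.naturality_Arr[of "\<epsilon> Y" "omap J (omap K Y)" Y]
    by (simp add: transpose_ad_Comp \<chi>_Unit counit_natural)
qed (auto simp: Hom_iff)

text \<open>After transposition, \<open>\<chi>_Mult\<close> replaces \<open>Mult S\<close> by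
  \<open>Mult T\<close> and doubles \<open>\<chi>\<close>; each copy of \<open>\<chi>\<close> is
  then absorbed into one copy of \<open>ad\<close>.\<close>

lemma ad_Mult:
  assumes [simp]: "Y \<in> Obj (Base T)"
  shows "\<phi> Y \<cdot> Mult S (omap K Y) =
    amap K (Mult T Y) \<cdot> \<phi> (omap (Endo T) Y) \<cdot> amap (Endo S) (\<phi> Y)"
proof (rule transpose_inject)
  let ?t = "omap (Endo T)" and ?T = "amap (Endo T)" and ?k = "omap K Y" and ?s = "omap (Endo S)"
  have "\<epsilon> (?t Y) \<star> amap J (\<phi> Y \<cdot> Mult S ?k) =
      ?T (\<epsilon> Y) \<star> Mult T (omap J ?k) \<star> ?T (\<chi> ?k) \<star> \<chi> (?s ?k)"
    by (simp add: transpose_ad_Comp \<chi>_Mult)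
  also have "\<dots> = Mult T Y \<star> ?T (?T (\<epsilon> Y)) \<star> ?T (\<chi> ?k) \<star> \<chi> (?s ?k)"
    using MT.naturality_Comp[of "\<epsilon> Y" "omap J ?k" Y "?T (\<chi> ?k) \<star> \<chi> (?s ?k)"] by simp
  also have "\<dots> = Mult T Y \<star> ?T (?T (\<epsilon> Y) \<star> \<chi> ?k) \<star> \<chi> (?s ?k)"
    by simp
  \<comment> \<open>\<open>transpose_ad\<close>, read from right to left under
    \<open>Endo T\<close>, produces \<open>\<phi> Y\<close>. Naturality of \<open>\<chi>\<close> at
    this arrow then prepares the second copy, \<open>\<phi> (?t Y)\<close>.\<close>
  also have "\<dots> = Mult T Y \<star> ?T (\<epsilon> (?t Y)) \<star> ?T (amap J (\<phi> Y)) \<star> \<chi> (?s ?k)"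
    by (simp add: transpose_ad[symmetric] del: ET.amap_Comp_simp) simp
  also have "?T (amap J (\<phi> Y)) \<star> \<chi> (?s ?k) = \<chi> (omap K (?t Y)) \<star> amap J (amap (Endo S) (\<phi> Y))"
    using \<chi>.naturality_Arr[of "\<phi> Y"] by simp
  also have "Mult T Y \<star> ?T (\<epsilon> (?t Y)) \<star> \<chi> (omap K (?t Y)) \<star> amap J (amap (Endo S) (\<phi> Y)) =
      \<epsilon> (?t Y) \<star> amap J (amap K (Mult T Y) \<cdot> \<phi> (?t Y) \<cdot> amap (Endo S) (\<phi> Y))"
    by (simp add: counit_natural_Comp transpose_ad_Comp)
  finally show "\<epsilon> (?t Y) \<star> amap J (\<phi> Y \<cdot> Mult S ?k) =
      \<epsilon> (?t Y) \<star> amap J (amap K (Mult T Y) \<cdot> \<phi> (?t Y) \<cdot> amap (Endo S) (\<phi> Y))" .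
qed (auto simp: Hom_iff)

lemma ad_one_cell: "mnd_one_cell T S \<lparr>Fun = K, Str = \<phi>\<rparr>"
proof (intro mnd_one_cell.intro mnd_one_cell_axioms.intro)
  show "natural_transformation (Base T) (Base S) (Endo S \<circ>\<^sub>F Fun \<lparr>Fun = K, Str = \<phi>\<rparr>)
      (Fun \<lparr>Fun = K, Str = \<phi>\<rparr> \<circ>\<^sub>F Endo T) (Str \<lparr>Fun = K, Str = \<phi>\<rparr>)"
    using ad_natural by simp
qed (simp_all add: cell.source.cat_monad_axioms cell.target.cat_monad_axioms
    adj.right.cat_functor_axioms nt_defs ad_Unit ad_Mult)

text \<open>The 2-cell condition for \<open>\<eta>\<close>. On transposes, naturality of
  \<open>\<chi>\<close> at \<open>\<eta> X\<close> brings the left triangle together under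
  \<open>Endo T\<close>, and \<open>\<psi>\<close> cancels \<open>\<chi>\<close>.\<close>

lemma unit_ad:
  assumes [simp]: "X \<in> Obj (Base S)"
  shows "amap K (\<psi> X) \<cdot> \<phi> (omap J X) \<cdot> amap (Endo S) (\<eta> X) = \<eta> (omap (Endo S) X)"
proof (rule transpose_inject)
  let ?s = "omap (Endo S)"
  have "\<epsilon> (omap J (?s X)) \<star> amap J (amap K (\<psi> X) \<cdot> \<phi> (omap J X) \<cdot> amap (Endo S) (\<eta> X)) =
      \<psi> X \<star> amap (Endo T) (\<epsilon> (omap J X)) \<star> \<chi> (omap K (omap J X)) \<star> amap J (amap (Endo S) (\<eta> X))"
    by (simp add: counit_natural_Comp transpose_ad_Comp)
  also have "\<dots> = \<psi> X \<star> amap (Endo T) (\<epsilon> (omap J X) \<star> amap J (\<eta> X)) \<star> \<chi> X"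
    \<comment> \<open>The triangle rule is withheld so that the composite under
      \<open>Endo T\<close> distributes to match the other side instead of collapsing.\<close>
    using \<chi>.naturality_Arr[of "\<eta> X"] by (simp del: triangle_left)
  also have "\<dots> = \<epsilon> (omap J (?s X)) \<star> amap J (\<eta> (?s X))"
    by (simp add: \<psi>_\<chi> del: ET.amap_Comp_simp)
  finally show "\<epsilon> (omap J (?s X)) \<star> amap J (amap K (\<psi> X) \<cdot> \<phi> (omap J X) \<cdot> amap (Endo S) (\<eta> X)) =
      \<epsilon> (omap J (?s X)) \<star> amap J (\<eta> (?s X))" .
qed (auto simp: Hom_iff)

text \<open>The 2-cell condition for \<open>\<epsilon>\<close>: the transpose of
  \<open>\<phi> Y\<close> ends in \<open>\<chi>\<close>, which cancels
  \<open>\<psi>\<close>.\<close>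

lemma counit_ad:
  assumes [simp]: "Y \<in> Obj (Base T)"
  shows "\<epsilon> (omap (Endo T) Y) \<star> amap J (\<phi> Y) \<star> \<psi> (omap K Y) = amap (Endo T) (\<epsilon> Y)"
  by (simp add: transpose_ad_Comp \<chi>_\<psi>)

text \<open>The triangle identities are those of the given adjunction; the 2-cell conditions are
  \<open>unit_ad\<close> and \<open>counit_ad\<close>.\<close>

lemma ad_adjoint_object:
  "adjoint_object S T \<lparr>Fun = J, Str = \<psi>\<rparr> \<lparr>Fun = K, Str = \<phi>\<rparr> \<eta> \<epsilon>"
proof (intro adjoint_object.intro adjoint_object_axioms.intro mnd_two_cell.intro
    mnd_two_cell_axioms.intro)
  note cells = cell.mnd_one_cell_axioms ad_one_cell
  show "mnd_one_cell S S (mnd_comp S \<lparr>Fun = K, Str = \<phi>\<rparr> \<lparr>Fun = J, Str = \<psi>\<rparr>)"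
    using cells by (rule mnd_comp_one_cell)
  show "mnd_one_cell T T (mnd_comp T \<lparr>Fun = J, Str = \<psi>\<rparr> \<lparr>Fun = K, Str = \<phi>\<rparr>)"
    using cells(2,1) by (rule mnd_comp_one_cell)
  show "mnd_one_cell S S (mnd_id S)" "mnd_one_cell T T (mnd_id T)"
    by (simp_all add: mnd_id_one_cell cell.source.cat_monad_axioms cell.target.cat_monad_axioms)
qed (use cell.mnd_one_cell_axioms ad_one_cell
    adj.unit.natural_transformation_axioms adj.counit.natural_transformation_axioms in
    \<open>simp_all add: nt_defs mnd_id_def mnd_comp_def unit_ad counit_ad triangle_right\<close>)

end

section \<open>From an adjoint object to an inverse of the structure map\<close>

context adjunction_one_cell
begin

lemma adjoint_object_invertible:
  assumes "adjoint_object S T \<lparr>Fun = J, Str = \<psi>\<rparr> \<lparr>Fun = K, Str = \<psi>K\<rparr> \<eta> \<epsilon>"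
  shows "nt_invertible (Base S) (Base T) (Endo T \<circ>\<^sub>F J) (J \<circ>\<^sub>F Endo S) \<psi>"
proof -
  interpret A: adjoint_object S T "\<lparr>Fun = J, Str = \<psi>\<rparr>" "\<lparr>Fun = K, Str = \<psi>K\<rparr>" \<eta> \<epsilon> by fact
  interpret \<psi>K: natural_transformation "Base T" "Base S" "Endo S \<circ>\<^sub>F K" "K \<circ>\<^sub>F Endo T" \<psi>K
    using A.right.Str_natural by simp
  let ?j = "omap J" and ?t = "omap (Endo T)" and ?s = "omap (Endo S)"
  \<comment> \<open>The witness is the transpose of
    \<open>\<psi>K (?j X) \<cdot> amap (Endo S) (\<eta> X)\<close>, that is, the mate of
    \<open>\<psi>K\<close>.\<close>
  define \<chi> where
    "\<chi> X = \<epsilon> (?t (?j X)) \<star> amap J (\<psi>K (?j X)) \<star> amap J (amap (Endo S) (\<eta> X))" for X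
  have counit: "\<epsilon> (?t Y) \<star> amap J (\<psi>K Y) \<star> \<psi> (omap K Y) = amap (Endo T) (\<epsilon> Y)"
    if "Y \<in> Obj (Base T)" for Y
    using A.counit.Str_compat that by (simp add: nt_defs mnd_comp_def mnd_id_def)
  have unit: "amap K (\<psi> X) \<cdot> \<psi>K (?j X) \<cdot> amap (Endo S) (\<eta> X) = \<eta> (?s X)"
    if "X \<in> Obj (Base S)" for X
    using A.unit.Str_compat that by (simp add: nt_defs mnd_comp_def mnd_id_def)
  have "nt_inverse (Base S) (Base T) (Endo T \<circ>\<^sub>F J) (J \<circ>\<^sub>F Endo S) \<psi> \<chi>"
  proof (rule nt_inverse_componentwise)
    fix X assume [simp]: "X \<in> Obj (Base S)"
    show "\<chi> X \<in> Hom (Base T) (omap (J \<circ>\<^sub>F Endo S) X) (omap (Endo T \<circ>\<^sub>F J) X)"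
      by (simp add: \<chi>_def Hom_iff)
    \<comment> \<open>Naturality of \<open>\<psi>\<close> at \<open>\<eta> X\<close> moves
      \<open>\<eta>\<close> to the right end and exposes the counit condition at
      \<open>?j X\<close>; the left triangle under \<open>Endo T\<close> then gives the
      identity.\<close>
    have "\<chi> X \<star> \<psi> X =
        (\<epsilon> (?t (?j X)) \<star> amap J (\<psi>K (?j X)) \<star> \<psi> (omap K (?j X))) \<star> amap (Endo T) (amap J (\<eta> X))"
      using \<psi>.naturality_Arr[of "\<eta> X"] by (simp add: \<chi>_def)
    also have "\<dots> = amap (Endo T) (\<epsilon> (?j X) \<star> amap J (\<eta> X))"
      by (simp add: counit del: triangle_left)
    finally show "\<chi> X \<star> \<psi> X = Ident (Base T) (omap (Endo T \<circ>\<^sub>F J) X)"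
      by (simp del: ET.amap_Comp_simp)
    \<comment> \<open>Naturality of \<open>\<epsilon>\<close> at \<open>\<psi> X\<close> makes the
      product the transpose of one side of the unit condition, hence of
      \<open>\<eta> (?s X)\<close>, which is an identity by the left triangle.\<close>
    have "\<psi> X \<star> \<chi> X =
        \<epsilon> (?j (?s X)) \<star> amap J (amap K (\<psi> X) \<cdot> \<psi>K (?j X) \<cdot> amap (Endo S) (\<eta> X))"
      by (simp add: \<chi>_def counit_natural_Comp)
    then show "\<psi> X \<star> \<chi> X = Ident (Base T) (omap (J \<circ>\<^sub>F Endo S) X)"
      by (simp add: unit del: adj.left.amap_Comp_simp)
  qed (rule \<psi>.natural_transformation_axioms)
  then show ?thesis by (auto simp: nt_invertible_def)
qed

end

theorem proposition2p2p2:
  fixes S :: "('o, 'a) mnd" and T :: "('p, 'b) mnd"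
    and J :: "('o, 'a, 'p, 'b) fctr" and K :: "('p, 'b, 'o, 'a) fctr"
    and \<eta> :: "('o, 'a) ntrans" and \<epsilon> :: "('p, 'b) ntrans"
    and \<psi>J :: "('o, 'b) ntrans"
  assumes "adjunction (Base S) (Base T) J K \<eta> \<epsilon>"
    and "mnd_one_cell S T \<lparr>Fun = J, Str = \<psi>J\<rparr>"
  shows "((\<exists>\<psi>K. adjoint_object S T \<lparr>Fun = J, Str = \<psi>J\<rparr> \<lparr>Fun = K, Str = \<psi>K\<rparr> \<eta> \<epsilon>)
           \<longleftrightarrow> nt_invertible (Base S) (Base T) (Endo T \<circ>\<^sub>F J) (J \<circ>\<^sub>F Endo S) \<psi>J)
         \<and> (\<forall>\<psi>K. adjoint_object S T \<lparr>Fun = J, Str = \<psi>J\<rparr> \<lparr>Fun = K, Str = \<psi>K\<rparr> \<eta> \<epsilon>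
           \<longrightarrow> nt_eq (Base T) \<psi>K (ad S T J K \<eta> \<epsilon> \<psi>J))"
proof -
  interpret adjunction_one_cell S T J K \<eta> \<epsilon> \<psi>J
    by (intro adjunction_one_cell.intro assms)
  have I: "invertible_adjunction_one_cell S T J K \<eta> \<epsilon> \<psi>J"
    if "nt_invertible (Base S) (Base T) (Endo T \<circ>\<^sub>F J) (J \<circ>\<^sub>F Endo S) \<psi>J"
    using that by unfold_locales
  \<comment> \<open>For the formula, an adjoint object first yields invertibility of
    \<open>\<psi>J\<close>, and \<open>ad_unique\<close> then applies.\<close>
  show ?thesis
    using adjoint_object_invertible invertible_adjunction_one_cell.ad_adjoint_object[OF I]
      invertible_adjunction_one_cell.ad_unique[OF I]
    by blast
qed

end
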